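(* Let $\mathbf{S}=\mathbf{V}\boldsymbol{\Lambda}\mathbf{V}^{\mathsf{H}}$ and $\hat{\mathbf{S}}$ be $N\times N$ graph shift operators. Let $\mathbf{E}=\mathbf{U}\mathbf{M}\mathbf{U}^{\mathsf{H}}\in\mathcal{E}(\mathbf{S},\hat{\mathbf{S}})$ be a relative perturbation matrix whose norm satisfies $$d(\mathbf{S},\hat{\mathbf{S}})\le\|\mathbf{E}\|\le\varepsilon.$$ Then for any integral Lipschitz filter $\mathbf{h}$ with integral Lipschitz constant $C$, $$\|\mathbf{H}(\mathbf{S})-\mathbf{H}(\hat{\mathbf{S}})\|_{\mathcal{P}}\le 2C\left(1+\delta\sqrt{N}\right)\varepsilon+\mathcal{O}(\varepsilon^2),$$ where $\delta:=(\|\mathbf{U}-\mathbf{V}\|_2+1)^2-1$ is the eigenvector misalignment between $\mathbf{S}$ and $\mathbf{E}$.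
   Context: A graph shift operator is a real symmetric $N\times N$ matrix; $\mathbf{S}=\mathbf{V}\boldsymbol{\Lambda}\mathbf{V}^{\mathsf{H}}$ with $\mathbf{V}$ orthonormal eigenvectors and $\boldsymbol{\Lambda}$ diagonal; $\mathbf{E}$ is symmetric with $\mathbf{U}$ orthonormal and $\mathbf{M}$ diagonal. $\|\cdot\|,\|\cdot\|_2$ denote spectral norm (Euclidean norm for vectors). $\mathcal{P}$ is the set of $N\times N$ permutation matrices. The set of relative perturbation matrices modulo permutation is $\mathcal{E}(\mathbf{S},\hat{\mathbf{S}})=\{\mathbf{E}:\mathbf{P}^{\mathsf{T}}\hat{\mathbf{S}}\mathbf{P}=\mathbf{S}+(\mathbf{E}\mathbf{S}+\mathbf{S}\mathbf{E})\text{ for some }\mathbf{P}\in\mathcal{P}\}$, and $d(\mathbf{S},\hat{\mathbf{S}})=\min\{\|\mathbf{E}\|:\mathbf{P}\in\mathcal{P},\ \mathbf{P}^{\mathsf{T}}\hat{\mathbf{S}}\mathbf{P}=\mathbf{S}+\mathbf{E}\mathbf{S}+\mathbf{S}\mathbf{E}\}$. For linear operators, $\|\mathbf{A}-\hat{\mathbf{A}}\|_{\mathcal{P}}=\min_{\mathbf{P}\in\mathcal{P}}\max_{\|\mathbf{x}\|=1}\|\mathbf{P}^{\mathsf{T}}(\mathbf{A}\mathbf{x})-\hat{\mathbf{A}}(\mathbf{P}^{\mathsf{T}}\mathbf{x})\|$. A filter $\mathbf{h}=\{h_k\}_{k\ge0}$ defines $\mathbf{H}(\mathbf{S})=\sum_k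 h_k\mathbf{S}^k$ and frequency response $h(\lambda)=\sum_k h_k\lambda^k$ (analytic), with $|h(\lambda)|\le1$. It is integral Lipschitz with constant $C>0$ if $|h(\lambda_2)-h(\lambda_1)|\le C\,\frac{|\lambda_2-\lambda_1|}{|\lambda_1+\lambda_2|/2}$ for all $\lambda_1,\lambda_2$. $\mathcal{O}(\varepsilon^2)$ denotes a term bounded by a constant times $\varepsilon^2$. *)

theory Defs
  imports "HOL-Analysis.Analysis"
begin

type_synonym 'n sqmat = "real^'n^'n"

(* spectral norm: operator norm induced by the Euclidean norm *)
definition spec_norm :: "'n::finite sqmat \<Rightarrow> real" where
  "spec_norm A = onorm (\<lambda>x. A *v x)"

definition diag_matrix :: "'n::finite sqmat \<Rightarrow> bool" where
  "diag_matrix A \<longleftrightarrow> (\<forall>i j. i \<noteq> j \<longrightarrow> A $ i $ j = 0)"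

(* graph shift operator: real symmetric matrix *)
definition gso :: "'n::finite sqmat \<Rightarrow> bool" where
  "gso S \<longleftrightarrow> transpose S = S"

(* permutation matrix of a permutation p *)
definition perm_matrix :: "('n::finite \<Rightarrow> 'n) \<Rightarrow> 'n sqmat" where
  "perm_matrix p = (\<chi> i j. if i = p j then 1 else 0)"

definition perm_matrices :: "'n::finite sqmat set" where
  "perm_matrices = {perm_matrix p | p. p permutes (UNIV :: 'n set)}"

(* set of relative perturbation matrices modulo permutation *)
definition rel_perts :: "'n::finite sqmat \<Rightarrow> 'n sqmat \<Rightarrow> 'n sqmat set" where
  "rel_perts S Sh = {E. \<exists>P \<in> perm_matrices.
      transpose P ** Sh ** P = S + (E ** S + S ** E)}"

(* d(S, Sh) = min of ||E|| over admissible (P, E) *)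
definition rel_dist :: "'n::finite sqmat \<Rightarrow> 'n sqmat \<Rightarrow> real" where
  "rel_dist S Sh = Inf (spec_norm ` rel_perts S Sh)"

(* || A - Ah ||_P for linear operators given as matrices *)
definition perm_op_dist :: "'n::finite sqmat \<Rightarrow> 'n sqmat \<Rightarrow> real" where
  "perm_op_dist A Ah = Inf ((\<lambda>P. onorm (\<lambda>x. transpose P *v (A *v x) - Ah *v (transpose P *v x)))
                          ` perm_matrices)"

fun mat_pow :: "'n::finite sqmat \<Rightarrow> nat \<Rightarrow> 'n sqmat" where
  "mat_pow A 0 = mat 1"
| "mat_pow A (Suc k) = A ** mat_pow A k"

(* graph filter H(S) = sum_k h_k S^k *)
definition graph_filter :: "(nat \<Rightarrow> real) \<Rightarrow> 'n::finite sqmat \<Rightarrow> 'n sqmat" where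
  "graph_filter h S = (\<Sum>k. h k *\<^sub>R mat_pow S k)"

(* frequency response h(lambda) = sum_k h_k lambda^k *)
definition freq_resp :: "(nat \<Rightarrow> real) \<Rightarrow> real \<Rightarrow> real" where
  "freq_resp h x = (\<Sum>k. h k * x ^ k)"

(* integral Lipschitz with constant C; the bound is vacuous (infinite) when lambda1 + lambda2 = 0 *)
definition integral_lipschitz :: "(nat \<Rightarrow> real) \<Rightarrow> real \<Rightarrow> bool" where
  "integral_lipschitz h C \<longleftrightarrow> C > 0 \<and>
     (\<forall>l1 l2. l1 + l2 \<noteq> 0 \<longrightarrow>
        \<bar>freq_resp h l2 - freq_resp h l1\<bar> \<le> C * (\<bar>l2 - l1\<bar> / (\<bar>l1 + l2\<bar> / 2)))"

end

theory Submission
  imports Defs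
begin

(* Conjugating by the permutation reduces the claim to bounding H(S + ES + SE) - H(S). In an
   eigenbasis V of S the first-order term of this difference has entries
   (la + lb) h[la, lb] (V^T E V)_ab, where h[la, lb] is the divided difference of the frequency
   response; the integral Lipschitz condition bounds (la + lb) h[la, lb] by 2C. Splitting V^T E V
   into the diagonal M and the misalignment V^T E V - M, of norm at most ((|U - V| + 1)^2 - 1)|M|,
   and paying sqrt N to pass through the Frobenius norm for the non-diagonal Schur product gives
   the first-order bound 2C(1 + delta sqrt N)|E|. The remainder of the power series is quadratic
   in E as long as eps <= 1; for eps > 1 the bound |H(X)| <= 1 for symmetric X (spectral theorem)
   is absorbed into K eps^2. *)

section \<open>Frobenius and spectral norms\<close>

text \<open>On \<open>real^'n^'m\<close> the library \<open>norm\<close> is the Frobenius norm.\<close>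

lemma matrix_add_rdistrib: "((A::'a::semiring_1^'n^'m) + B) ** (C::'a^'k^'n) = A ** C + B ** C"
  by (simp add: matrix_matrix_mult_def vec_eq_iff sum.distrib distrib_right)

lemma matrix_diff_rdistrib: "((A::'a::ring_1^'n^'m) - B) ** (C::'a^'k^'n) = A ** C - B ** C"
  by (simp add: matrix_matrix_mult_def vec_eq_iff sum_subtractf left_diff_distrib)

lemma matrix_diff_ldistrib: "(C::'a::ring_1^'n^'m) ** ((A::'a^'k^'n) - B) = C ** A - C ** B"
  by (simp add: matrix_matrix_mult_def vec_eq_iff sum_subtractf right_diff_distrib)

lemma norm_matrix_power2: "(norm (A::real^'n^'m))\<^sup>2 = (\<Sum>i\<in>UNIV. \<Sum>j\<in>UNIV. (A$i$j)\<^sup>2)"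
  unfolding norm_vec_def L2_set_def by (simp add: sum_nonneg)

lemma norm_transpose_matrix: "norm (transpose (A::real^'n^'m)) = norm A"
proof -
  have "(norm (transpose A))\<^sup>2 = (\<Sum>i\<in>UNIV. \<Sum>j\<in>UNIV. (A$j$i)\<^sup>2)"
    by (simp add: norm_matrix_power2 transpose_def)
  also have "\<dots> = (norm A)\<^sup>2"
    unfolding norm_matrix_power2 by (rule sum.swap)
  finally have "(norm (transpose A))\<^sup>2 = (norm A)\<^sup>2" .
  then show ?thesis by simp
qed

lemma norm_matrix_vector_mult_le: "norm ((A::real^'n^'m) *v x) \<le> norm A * norm x"
proof -
  have "(norm (A *v x))\<^sup>2 = (\<Sum>i\<in>UNIV. (inner (A$i) x)\<^sup>2)"
    unfolding norm_vec_def L2_set_def matrix_mult_dot by (simp add: sum_nonneg)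
  also have "\<dots> \<le> (\<Sum>i\<in>UNIV. (norm (A$i))\<^sup>2 * (norm x)\<^sup>2)"
  proof (rule sum_mono)
    fix i
    have "\<bar>inner (A$i) x\<bar> \<le> norm (A$i) * norm x" by (rule Cauchy_Schwarz_ineq2)
    then show "(inner (A$i) x)\<^sup>2 \<le> (norm (A$i))\<^sup>2 * (norm x)\<^sup>2"
      by (metis abs_ge_zero power2_abs power_mono power_mult_distrib)
  qed
  also have "\<dots> = (norm A * norm x)\<^sup>2"
    unfolding norm_vec_def[of A] L2_set_def
    by (simp add: sum_nonneg sum_distrib_right power_mult_distrib)
  finally show ?thesis
    by (rule power2_le_imp_le) simp
qed

lemma norm_matrix_mult_le: "norm ((A::real^'n^'m) ** (B::real^'k^'n)) \<le> norm A * norm B"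
proof -
  have row: "(A ** B)$i = transpose B *v (A$i)" for i
    by (simp add: vec_eq_iff matrix_matrix_mult_def vector_matrix_mult_def)
  have "(norm (A ** B))\<^sup>2 = (\<Sum>i\<in>UNIV. (norm ((A ** B)$i))\<^sup>2)"
    unfolding norm_vec_def[of "A ** B"] L2_set_def by (simp add: sum_nonneg)
  also have "\<dots> \<le> (\<Sum>i\<in>UNIV. (norm B)\<^sup>2 * (norm (A$i))\<^sup>2)"
  proof (rule sum_mono)
    fix i
    have "norm ((A ** B)$i) \<le> norm B * norm (A$i)"
      using norm_matrix_vector_mult_le[of "transpose B" "A$i"] by (simp only: row norm_transpose_matrix)
    then show "(norm ((A ** B)$i))\<^sup>2 \<le> (norm B)\<^sup>2 * (norm (A$i))\<^sup>2"
      by (metis norm_ge_zero power_mono power_mult_distrib)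
  qed
  also have "\<dots> = (norm A * norm B)\<^sup>2"
    unfolding norm_vec_def[of A] L2_set_def
    by (simp add: sum_nonneg sum_distrib_left power_mult_distrib mult.commute)
  finally show ?thesis
    by (rule power2_le_imp_le) simp
qed

lemma spec_norm_bound: "norm ((A::'n::finite sqmat) *v x) \<le> spec_norm A * norm x"
  unfolding spec_norm_def using onorm[OF matrix_vector_mul_bounded_linear] by blast

lemma spec_norm_leI: "(\<And>x. norm ((A::'n::finite sqmat) *v x) \<le> b * norm x) \<Longrightarrow> spec_norm A \<le> b"
  unfolding spec_norm_def by (rule onorm_le)

lemma spec_norm_nonneg: "0 \<le> spec_norm (A::'n::finite sqmat)"
  unfolding spec_norm_def by (rule onorm_pos_le[OF matrix_vector_mul_bounded_linear])

lemma spec_norm_le_norm: "spec_norm (A::'n::finite sqmat) \<le> norm A"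
  by (rule spec_norm_leI) (rule norm_matrix_vector_mult_le)

lemma abs_entry_le_spec_norm: "\<bar>(A::'n::finite sqmat) $ i $ j\<bar> \<le> spec_norm A"
  unfolding spec_norm_def by (rule matrix_component_le_onorm)

lemma spec_norm_mult_le: "spec_norm ((A::'n::finite sqmat) ** B) \<le> spec_norm A * spec_norm B"
proof -
  have "(*v) (A ** B) = (*v) A \<circ> (*v) B"
    by (simp add: fun_eq_iff matrix_vector_mul_assoc)
  then show ?thesis
    unfolding spec_norm_def by (simp add: onorm_compose)
qed

lemma spec_norm_add_le: "spec_norm ((A::'n::finite sqmat) + B) \<le> spec_norm A + spec_norm B"
proof -
  have "(*v) (A + B) = (\<lambda>x. A *v x + B *v x)"
    by (simp add: fun_eq_iff matrix_vector_mult_add_rdistrib)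
  then show ?thesis
    unfolding spec_norm_def by (simp add: onorm_triangle)
qed

lemma spec_norm_uminus: "spec_norm (- (A::'n::finite sqmat)) = spec_norm A"
proof -
  have "(*v) (- A) = (\<lambda>x. - (A *v x))"
    by (simp add: fun_eq_iff vec_eq_iff matrix_vector_mult_def sum_negf)
  then show ?thesis unfolding spec_norm_def by (simp add: onorm_neg)
qed

lemma spec_norm_diff_commute: "spec_norm ((A::'n::finite sqmat) - B) = spec_norm (B - A)"
  by (metis minus_diff_eq spec_norm_uminus)

lemma spec_norm_diff_le: "spec_norm ((A::'n::finite sqmat) - B) \<le> spec_norm A + spec_norm B"
  using spec_norm_add_le[of A "- B"] by (simp add: spec_norm_uminus)

lemma spec_norm_transpose: "spec_norm (transpose (A::'n::finite sqmat)) = spec_norm A"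
proof -
  have le: "spec_norm (transpose B) \<le> spec_norm B" for B :: "'n sqmat"
  proof (rule spec_norm_leI)
    fix x :: "real^'n"
    let ?y = "transpose B *v x"
    have "(norm ?y)\<^sup>2 = inner x (B *v ?y)"
      by (metis power2_norm_eq_inner dot_lmul_matrix transpose_matrix_vector)
    also have "\<dots> \<le> norm x * (spec_norm B * norm ?y)"
      by (rule order_trans[OF norm_cauchy_schwarz mult_left_mono[OF spec_norm_bound norm_ge_zero]])
    finally have "norm ?y * norm ?y \<le> (spec_norm B * norm x) * norm ?y"
      by (simp add: power2_eq_square ac_simps)
    then show "norm ?y \<le> spec_norm B * norm x"
      by (metis mult_right_le_imp_le norm_ge_zero
          order_le_less spec_norm_nonneg zero_le_mult_iff)
  qed
  show ?thesis
    using le[of A] le[of "transpose A"] by simp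
qed

lemma norm_le_sqrt_card_spec_norm: "norm (A::'n::finite sqmat) \<le> sqrt (real CARD('n)) * spec_norm A"
proof -
  have "(norm A)\<^sup>2 = (\<Sum>j\<in>UNIV. (norm (column j A))\<^sup>2)"
    unfolding norm_transpose_matrix[of A, symmetric] norm_vec_def[of "transpose A"] L2_set_def
    by (simp add: sum_nonneg column_def transpose_def)
  also have "\<dots> \<le> (\<Sum>j\<in>(UNIV::'n set). (spec_norm A)\<^sup>2)"
    using norm_column_le_onorm[of _ A] unfolding spec_norm_def
    by (intro sum_mono) (metis norm_ge_zero power_mono)
  also have "\<dots> = (sqrt (real CARD('n)) * spec_norm A)\<^sup>2"
    by (simp add: power_mult_distrib)
  finally show ?thesis
    by (rule power2_le_imp_le) (simp add: spec_norm_nonneg)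
qed

lemma spec_norm_diagonal_le:
  assumes "diag_matrix (D::'n::finite sqmat)" and "\<And>i. \<bar>D$i$i\<bar> \<le> m"
  shows "spec_norm D \<le> m"
proof (rule spec_norm_leI)
  fix x :: "real^'n"
  have Dx: "(D *v x)$i = D$i$i * x$i" for i
    using assms(1) unfolding diag_matrix_def matrix_vector_mult_def
    by (simp add: sum.remove[of UNIV i] sum.neutral)
  have m0: "0 \<le> m" using assms(2) abs_ge_zero order_trans by blast
  have "(norm (D *v x))\<^sup>2 = (\<Sum>i\<in>UNIV. (D$i$i)\<^sup>2 * (x$i)\<^sup>2)"
    unfolding norm_vec_def L2_set_def by (simp add: sum_nonneg Dx power_mult_distrib)
  also have "\<dots> \<le> (\<Sum>i\<in>UNIV. m\<^sup>2 * (x$i)\<^sup>2)"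
    using assms(2) m0 by (intro sum_mono mult_right_mono) (simp_all add: power2_le_iff_abs_le)
  also have "\<dots> = (m * norm x)\<^sup>2"
    unfolding norm_vec_def L2_set_def by (simp add: sum_nonneg sum_distrib_left power_mult_distrib)
  finally show "norm (D *v x) \<le> m * norm x"
    by (rule power2_le_imp_le) (simp add: m0)
qed

lemma norm_hadamard_le:
  assumes "\<And>i j. \<bar>G i j\<bar> \<le> g"
  shows "norm ((\<chi> i j. G i j * (X::real^'n^'m)$i$j) :: real^'n^'m) \<le> g * norm X"
proof -
  have g0: "0 \<le> g" using assms abs_ge_zero order_trans by blast
  have "(norm ((\<chi> i j. G i j * X$i$j) :: real^'n^'m))\<^sup>2
      = (\<Sum>i\<in>UNIV. \<Sum>j\<in>UNIV. (G i j)\<^sup>2 * (X$i$j)\<^sup>2)"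
    by (simp add: norm_matrix_power2 power_mult_distrib)
  also have "\<dots> \<le> (\<Sum>i\<in>UNIV. \<Sum>j\<in>UNIV. g\<^sup>2 * (X$i$j)\<^sup>2)"
    using assms g0 by (intro sum_mono mult_right_mono) (simp_all add: power2_le_iff_abs_le)
  also have "\<dots> = (g * norm X)\<^sup>2"
    by (simp add: norm_matrix_power2 power_mult_distrib sum_distrib_left)
  finally show ?thesis
    by (rule power2_le_imp_le) (simp add: g0)
qed

lemma norm_orthogonal_matrix_vector_mult:
  "orthogonal_matrix (Q::'n::finite sqmat) \<Longrightarrow> norm (Q *v x) = norm x"
  by (metis orthogonal_transformation_matrix orthogonal_transformation_norm
        matrix_of_matrix_vector_mul matrix_vector_mul_linear)

lemma spec_norm_orthogonal_le: "orthogonal_matrix (Q::'n::finite sqmat) \<Longrightarrow> spec_norm Q \<le> 1"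
  by (rule spec_norm_leI) (simp add: norm_orthogonal_matrix_vector_mult)

lemma spec_norm_orthogonal_mult_left:
  assumes "orthogonal_matrix (Q::'n::finite sqmat)"
  shows "spec_norm (Q ** A) = spec_norm A"
proof -
  have le: "spec_norm (R ** B) \<le> spec_norm B" if "orthogonal_matrix R" for R B :: "'n sqmat"
  proof -
    have "spec_norm (R ** B) \<le> spec_norm R * spec_norm B" by (rule spec_norm_mult_le)
    also have "\<dots> \<le> 1 * spec_norm B"
      by (rule mult_right_mono[OF spec_norm_orthogonal_le[OF that] spec_norm_nonneg])
    finally show ?thesis by simp
  qed
  have "A = transpose Q ** (Q ** A)"
    using assms by (simp add: matrix_mul_assoc orthogonal_matrix_def)
  then have "spec_norm A \<le> spec_norm (Q ** A)"
    using le[of "transpose Q" "Q ** A"] assms by simp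
  with le[OF assms, of A] show ?thesis by (rule order_antisym)
qed

lemma spec_norm_orthogonal_mult_right:
  assumes "orthogonal_matrix (Q::'n::finite sqmat)"
  shows "spec_norm (A ** Q) = spec_norm A"
  using spec_norm_orthogonal_mult_left[of "transpose Q" "transpose A"] assms
  by (simp add: spec_norm_transpose flip: matrix_transpose_mul)

lemma spec_norm_orthogonal_conj:
  "orthogonal_matrix (Q::'n::finite sqmat) \<Longrightarrow> spec_norm (Q ** A ** transpose Q) = spec_norm A"
  by (simp add: spec_norm_orthogonal_mult_left spec_norm_orthogonal_mult_right)


section \<open>Spectral theorem for real symmetric matrices\<close>

lemma symmetric_matrix_inner:
  assumes "transpose A = (A::'n::finite sqmat)"
  shows "inner (A *v x) y = inner x (A *v y)"
  by (metis assms dot_lmul_matrix transpose_matrix_vector)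

lemma rayleigh_quotient_le_max:
  fixes A :: "'n::finite sqmat"
  assumes W: "subspace W" and max: "\<And>z. z \<in> W \<Longrightarrow> norm z = 1 \<Longrightarrow> inner z (A *v z) \<le> \<mu>"
    and z: "z \<in> W"
  shows "inner z (A *v z) \<le> \<mu> * (norm z)\<^sup>2"
proof (cases "z = 0")
  case False
  have "inner (z /\<^sub>R norm z) (A *v (z /\<^sub>R norm z)) \<le> \<mu>"
    using z False W by (intro max) (simp_all add: subspace_scale)
  moreover have "inner z (A *v z) = (norm z)\<^sup>2 * inner (z /\<^sub>R norm z) (A *v (z /\<^sub>R norm z))"
    using False by (simp add: matrix_vector_mult_scaleR power2_eq_square field_simps)
  ultimately show ?thesis
    by (metis mult.commute mult_left_mono zero_le_power2)
qed simp

lemma rayleigh_maximizer_eigenvector: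
  fixes A :: "'n::finite sqmat"
  assumes sym: "transpose A = A" and W: "subspace W" and inv: "\<forall>x\<in>W. A *v x \<in> W"
    and x0: "x0 \<in> W" "norm x0 = 1"
    and max: "\<And>z. z \<in> W \<Longrightarrow> norm z = 1 \<Longrightarrow> inner z (A *v z) \<le> inner x0 (A *v x0)"
  shows "A *v x0 = inner x0 (A *v x0) *\<^sub>R x0"
proof -
  define q where "q z = inner z (A *v z)" for z
  define \<mu> where "\<mu> = q x0"
  have x0x0: "inner x0 x0 = 1" using x0(2) by (simp add: dot_square_norm)
  have q_le: "q z \<le> \<mu> * (norm z)\<^sup>2" if "z \<in> W" for z
    unfolding q_def \<mu>_def using W max that by (rule rayleigh_quotient_le_max)
  define y where "y = A *v x0 - \<mu> *\<^sub>R x0"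
  have yW: "y \<in> W" unfolding y_def using inv x0 W by (simp add: subspace_diff subspace_scale)
  have y_x0: "inner y x0 = 0"
    using x0x0 by (simp add: y_def \<mu>_def q_def inner_diff_left inner_diff_right inner_commute)
  have y_Ax0: "inner y (A *v x0) = (norm y)\<^sup>2"
    using y_x0 by (simp add: y_def inner_diff_right power2_norm_eq_inner)
  have x0_Ay: "inner x0 (A *v y) = (norm y)\<^sup>2"
    using y_Ax0 symmetric_matrix_inner[OF sym, of x0 y] by (simp add: inner_commute)
  have bound: "2 * (norm y)\<^sup>2 \<le> t * (\<mu> * (norm y)\<^sup>2 - q y)" if "t > 0" for t
  proof -
    have "q (x0 + t *\<^sub>R y) \<le> \<mu> * (norm (x0 + t *\<^sub>R y))\<^sup>2"
      using x0 yW W by (intro q_le) (simp add: subspace_add subspace_scale)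
    moreover have "q (x0 + t *\<^sub>R y) = \<mu> + 2 * t * (norm y)\<^sup>2 + t\<^sup>2 * q y"
      unfolding q_def \<mu>_def
      by (simp add: y_Ax0 x0_Ay power2_eq_square algebra_simps)
    moreover have "(norm (x0 + t *\<^sub>R y))\<^sup>2 = 1 + t\<^sup>2 * (norm y)\<^sup>2"
      using y_x0 x0(2) by (simp add: norm_add_Pythagorean orthogonal_def inner_commute power_mult_distrib)
    ultimately have "t * (2 * (norm y)\<^sup>2) \<le> t * (t * (\<mu> * (norm y)\<^sup>2 - q y))"
      by (simp add: power2_eq_square algebra_simps)
    then show ?thesis using that by simp
  qed
  \<comment> \<open>letting \<open>t \<rightarrow> 0\<close> forces \<open>y = 0\<close>\<close>
  have "((\<lambda>t. t * (\<mu> * (norm y)\<^sup>2 - q y)) \<longlongrightarrow> 0) (at_right 0)"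
    by (auto intro!: tendsto_eq_intros)
  moreover have "\<forall>\<^sub>F t in at_right 0. 2 * (norm y)\<^sup>2 \<le> t * (\<mu> * (norm y)\<^sup>2 - q y)"
    using bound by (intro eventually_at_rightI[of 0 1]) auto
  ultimately have "2 * (norm y)\<^sup>2 \<le> 0"
    by (rule tendsto_lowerbound) simp
  then show ?thesis by (simp add: y_def \<mu>_def q_def)
qed

lemma symmetric_matrix_invariant_subspace_eigenvector:
  fixes A :: "'n::finite sqmat"
  assumes sym: "transpose A = A" and W: "subspace W" and inv: "\<forall>x\<in>W. A *v x \<in> W"
    and nontrivial: "W \<noteq> {0}"
  obtains x0 where "x0 \<in> W" "norm x0 = 1" "A *v x0 = inner x0 (A *v x0) *\<^sub>R x0"
proof -
  obtain x1 where x1: "x1 \<in> W" "x1 \<noteq> 0" using nontrivial subspace_0[OF W] by blast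
  have "x1 /\<^sub>R norm x1 \<in> W \<inter> sphere 0 1" using x1 W by (simp add: subspace_scale)
  moreover have "compact (W \<inter> sphere 0 1)"
    using compact_Int_closed[OF compact_sphere closed_subspace[OF W]] by (simp add: Int_commute)
  moreover have "continuous_on (W \<inter> sphere 0 1) (\<lambda>z. inner z (A *v z))"
    by (intro continuous_intros)
  ultimately obtain x0 where x0: "x0 \<in> W \<inter> sphere 0 1"
    and max: "\<And>z. z \<in> W \<inter> sphere 0 1 \<Longrightarrow> inner z (A *v z) \<le> inner x0 (A *v x0)"
    using continuous_attains_sup[of "W \<inter> sphere 0 1" "\<lambda>z. inner z (A *v z)"] by blast
  then have "x0 \<in> W" "norm x0 = 1" by auto
  with max show ?thesis
    by (intro that rayleigh_maximizer_eigenvector[OF sym W inv]) auto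
qed

lemma span_insert_orthogonal_complement:
  assumes W: "subspace W" and x0: "x0 \<in> W" "norm x0 = 1"
    and B: "span B = {z\<in>W. inner z x0 = 0}"
  shows "span (insert x0 B) = W"
proof
  have "B \<subseteq> W" using B span_superset by blast
  then show "span (insert x0 B) \<subseteq> W" using x0(1) W by (intro span_minimal) auto
  show "W \<subseteq> span (insert x0 B)"
  proof
    fix w assume "w \<in> W"
    then have "w - inner w x0 *\<^sub>R x0 \<in> span B"
      using x0 W B by (simp add: subspace_diff subspace_scale inner_diff_left dot_square_norm)
    then have "w - inner w x0 *\<^sub>R x0 \<in> span (insert x0 B)"
      using span_mono[of B "insert x0 B"] by auto
    then show "w \<in> span (insert x0 B)"
      by (metis span_add_eq span_base span_scale insertI1 diff_add_cancel)
  qed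
qed

lemma orthogonal_complement_eigenvector_invariant:
  fixes A :: "'n::finite sqmat"
  assumes sym: "transpose A = A" and W: "subspace W" and inv: "\<forall>x\<in>W. A *v x \<in> W"
    and eig: "A *v x0 = c *\<^sub>R x0"
  shows "subspace {z\<in>W. inner z x0 = 0}" and "\<forall>z\<in>{z\<in>W. inner z x0 = 0}. A *v z \<in> {z\<in>W. inner z x0 = 0}"
proof -
  show "subspace {z\<in>W. inner z x0 = 0}"
    using W unfolding subspace_def by (auto simp: inner_add_left)
  have "inner (A *v z) x0 = 0" if "inner z x0 = 0" for z
    using that symmetric_matrix_inner[OF sym, of z x0] by (simp add: eig)
  with inv show "\<forall>z\<in>{z\<in>W. inner z x0 = 0}. A *v z \<in> {z\<in>W. inner z x0 = 0}" by simp
qed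

lemma symmetric_matrix_orthonormal_eigenbasis_subspace:
  fixes A :: "'n::finite sqmat"
  assumes sym: "transpose A = A"
  shows "subspace W \<Longrightarrow> (\<forall>x\<in>W. A *v x \<in> W) \<Longrightarrow>
    \<exists>B. B \<subseteq> W \<and> pairwise orthogonal B \<and> span B = W \<and>
        (\<forall>b\<in>B. norm b = 1 \<and> A *v b = inner b (A *v b) *\<^sub>R b)"
proof (induction "dim W" arbitrary: W rule: less_induct)
  case less
  note W = less.prems(1) and inv = less.prems(2)
  show ?case
  proof (cases "W = {0}")
    case True
    then show ?thesis by (intro exI[of _ "{}"]) auto
  next
    case False
    then obtain x0 where x0: "x0 \<in> W" "norm x0 = 1" and eig: "A *v x0 = inner x0 (A *v x0) *\<^sub>R x0"
      using symmetric_matrix_invariant_subspace_eigenvector[OF sym W inv] by blast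
    define W' where "W' = {z\<in>W. inner z x0 = 0}"
    have W': "subspace W'" "\<forall>z\<in>W'. A *v z \<in> W'"
      unfolding W'_def by (rule orthogonal_complement_eigenvector_invariant[OF sym W inv eig])+
    moreover have "dim W' < dim W"
    proof -
      have "x0 \<notin> W'" using x0 unfolding W'_def by (simp add: dot_square_norm)
      then have "W' \<subset> W" using x0 unfolding W'_def by blast
      then show ?thesis using subspace_dim_equal[OF W'(1) W] dim_subset[of W' W] by fastforce
    qed
    ultimately obtain B' where B': "B' \<subseteq> W'" "pairwise orthogonal B'" "span B' = W'"
      "\<forall>b\<in>B'. norm b = 1 \<and> A *v b = inner b (A *v b) *\<^sub>R b"
      using less.hyps[OF _ W'(1,2)] by blast
    show ?thesis
    proof (intro exI[of _ "insert x0 B'"] conjI)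
      show "insert x0 B' \<subseteq> W" using B'(1) x0 unfolding W'_def by blast
      have "\<forall>y\<in>B'. inner y x0 = 0" using B'(1) unfolding W'_def by blast
      then show "pairwise orthogonal (insert x0 B')"
        by (simp add: pairwise_insert B'(2)) (auto simp: orthogonal_def inner_commute)
      show "span (insert x0 B') = W"
        using span_insert_orthogonal_complement[OF W x0] B'(3) unfolding W'_def by blast
      show "\<forall>b\<in>insert x0 B'. norm b = 1 \<and> A *v b = inner b (A *v b) *\<^sub>R b"
        using B'(4) x0 eig by blast
    qed
  qed
qed

lemma symmetric_matrix_orthogonally_diagonalizable:
  fixes A :: "'n::finite sqmat"
  assumes sym: "transpose A = A"
  shows "\<exists>Q D. orthogonal_matrix Q \<and> diag_matrix D \<and> A = Q ** D ** transpose Q"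
proof -
  obtain B where B: "pairwise orthogonal B" "span B = UNIV"
    "\<forall>b\<in>B. norm b = 1 \<and> A *v b = inner b (A *v b) *\<^sub>R b"
    using symmetric_matrix_orthonormal_eigenbasis_subspace[OF sym, of UNIV] by auto
  have "0 \<notin> B" using B(3) by auto
  then have ind: "independent B" by (rule pairwise_orthogonal_independent[OF B(1)])
  then have "card B = CARD('n)"
    using dim_span_eq_card_independent[OF ind] B(2) by simp
  then obtain f where f: "bij_betw f (UNIV::'n set) B"
    using finite_same_card_bij[of "UNIV::'n set" B] independent_imp_finite[OF ind] by auto
  have fB: "f j \<in> B" for j using f by (auto simp: bij_betw_def)
  define Q where "Q = ((\<chi> i j. f j $ i) :: 'n sqmat)"
  define \<mu> where "\<mu> j = inner (f j) (A *v f j)" for j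
  define D where "D = ((\<chi> i j. if i = j then \<mu> j else 0) :: 'n sqmat)"
  have col: "column j Q = f j" for j by (simp add: Q_def column_def vec_eq_iff)
  have Q: "orthogonal_matrix Q"
    unfolding orthogonal_matrix_orthonormal_columns col
    using B(1,3) fB f unfolding pairwise_def bij_betw_def inj_def by metis
  have "A ** Q = Q ** D"
  proof -
    have "A *v f j = \<mu> j *\<^sub>R f j" for j using B(3) fB[of j] unfolding \<mu>_def by blast
    then have "(A ** Q) $ i $ j = (Q ** D) $ i $ j" for i j
      unfolding matrix_matrix_mult_def D_def Q_def
      by (simp add: matrix_vector_mult_def vec_eq_iff if_distrib if_distribR cong: if_cong)
    then show ?thesis by (simp add: vec_eq_iff)
  qed
  then have "A = Q ** D ** transpose Q"
    using Q by (metis matrix_mul_assoc matrix_mul_rid orthogonal_matrix_def)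
  moreover have "diag_matrix D" unfolding D_def diag_matrix_def by simp
  ultimately show ?thesis using Q by blast
qed


section \<open>Graph filters\<close>

lemma orthogonal_matrix_mult_cancel:
  assumes "orthogonal_matrix (Q::'n::finite sqmat)"
  shows "X ** transpose Q ** Q = X" and "X ** Q ** transpose Q = X"
  using assms by (simp_all add: orthogonal_matrix_def flip: matrix_mul_assoc)

lemma mat_pow_orthogonal_conj:
  assumes "orthogonal_matrix (Q::'n::finite sqmat)"
  shows "mat_pow (Q ** A ** transpose Q) k = Q ** mat_pow A k ** transpose Q"
proof (induction k)
  case 0
  then show ?case using assms by (simp add: orthogonal_matrix_def)
next
  case (Suc k)
  have "mat_pow (Q ** A ** transpose Q) (Suc k)
      = Q ** A ** (transpose Q ** Q) ** mat_pow A k ** transpose Q"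
    using Suc by (simp add: matrix_mul_assoc)
  also have "\<dots> = Q ** mat_pow A (Suc k) ** transpose Q"
    using assms by (simp add: orthogonal_matrix_def matrix_mul_assoc)
  finally show ?case .
qed

lemma diag_matrix_mult_left:
  "diag_matrix (L::'n::finite sqmat) \<Longrightarrow> (L ** X) $ a $ b = L$a$a * X$a$b"
  unfolding matrix_matrix_mult_def diag_matrix_def
  by (simp, subst sum.remove[of UNIV a]) (auto intro!: sum.neutral)

lemma diag_matrix_mult_right:
  "diag_matrix (L::'n::finite sqmat) \<Longrightarrow> (X ** L) $ a $ b = X$a$b * L$b$b"
  unfolding matrix_matrix_mult_def diag_matrix_def
  by (simp, subst sum.remove[of UNIV b]) (auto intro!: sum.neutral)

lemma mat_pow_diag:
  assumes "diag_matrix (D::'n::finite sqmat)"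
  shows "mat_pow D k = (\<chi> i j. if i = j then (D$i$i)^k else 0)"
  by (induction k) (simp_all add: mat_def vec_eq_iff diag_matrix_mult_left[OF assms])

lemma diag_matrix_mat_pow: "diag_matrix D \<Longrightarrow> diag_matrix (mat_pow D k)"
  by (simp add: mat_pow_diag diag_matrix_def)

lemma norm_mat_pow_le:
  assumes "norm (A::'n::finite sqmat) \<le> R"
  shows "norm (mat_pow A k) \<le> norm (mat 1 :: 'n sqmat) * R ^ k"
proof (induction k)
  case (Suc k)
  have "norm (mat_pow A (Suc k)) \<le> norm A * norm (mat_pow A k)"
    by (simp add: norm_matrix_mult_le)
  also have "\<dots> \<le> R * (norm (mat 1 :: 'n sqmat) * R ^ k)"
    using assms Suc order_trans[OF norm_ge_zero assms] by (intro mult_mono) auto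
  finally show ?case by (simp add: ac_simps)
qed simp

lemma summable_abs_powser:
  assumes "\<forall>x. summable (\<lambda>k. h k * x ^ k)" and "0 \<le> (r::real)"
  shows "summable (\<lambda>k. \<bar>h k\<bar> * r ^ k)"
  using powser_insidea[of h "r + 1" r] assms by (simp add: abs_mult)

lemma summable_abs_powser_mult_power2:
  assumes "\<forall>x. summable (\<lambda>k. h k * x ^ k)" and "0 \<le> (r::real)"
  shows "summable (\<lambda>k. \<bar>h k\<bar> * (real k)\<^sup>2 * r ^ k)"
proof (rule summable_comparison_test')
  show "summable (\<lambda>k. \<bar>h k\<bar> * (4 * r) ^ k)"
    using summable_abs_powser[OF assms(1), of "4 * r"] assms(2) by simp
  fix k :: nat
  \<comment> \<open>\<open>k\<^sup>2 \<le> 4\<^sup>k\<close> because \<open>k \<le> 2\<^sup>k\<close>\<close>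
  have "(real k)\<^sup>2 \<le> (2 ^ k)\<^sup>2"
    by (rule power_mono) (simp_all add: less_exp[of k, THEN less_imp_le, folded of_nat_le_iff])
  also have "\<dots> = 4 ^ k" by (simp add: power2_eq_square flip: power_mult_distrib)
  finally show "norm (\<bar>h k\<bar> * (real k)\<^sup>2 * r ^ k) \<le> \<bar>h k\<bar> * (4 * r) ^ k"
    using assms(2) by (simp add: power_mult_distrib mult_left_mono mult_right_mono mult.assoc)
qed

lemma summable_abs_powser_mult_nat:
  assumes "\<forall>x. summable (\<lambda>k. h k * x ^ k)" and "0 \<le> (r::real)"
  shows "summable (\<lambda>k. \<bar>h k\<bar> * real k * r ^ k)"
proof (rule summable_comparison_test'[OF summable_abs_powser_mult_power2[OF assms]])
  fix k :: nat
  have "real k \<le> (real k)\<^sup>2" by (cases k) (auto simp: power2_eq_square)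
  then show "norm (\<bar>h k\<bar> * real k * r ^ k) \<le> \<bar>h k\<bar> * (real k)\<^sup>2 * r ^ k"
    using assms(2) by (simp add: mult_right_mono mult_left_mono)
qed

lemma summable_graph_filter:
  assumes "\<forall>x. summable (\<lambda>k. h k * x ^ k)"
  shows "summable (\<lambda>k. h k *\<^sub>R mat_pow (A::'n::finite sqmat) k)"
proof (rule summable_comparison_test')
  show "summable (\<lambda>k. norm (mat 1 :: 'n sqmat) * (\<bar>h k\<bar> * norm A ^ k))"
    by (rule summable_mult) (rule summable_abs_powser[OF assms norm_ge_zero])
  show "norm (h k *\<^sub>R mat_pow A k) \<le> norm (mat 1 :: 'n sqmat) * (\<bar>h k\<bar> * norm A ^ k)" for k
    using norm_mat_pow_le[of A "norm A" k] by (simp add: mult_left_mono ac_simps)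
qed

lemma bounded_linear_matrix_sandwich: "bounded_linear (\<lambda>X::real^'n^'m. Q ** X ** (R::real^'k^'n))"
proof (rule bounded_linear_intro[where K = "norm Q * norm R"])
  show "Q ** (X + Y) ** R = Q ** X ** R + Q ** Y ** R" for X Y
    by (simp add: matrix_add_ldistrib matrix_add_rdistrib)
  show "Q ** (c *\<^sub>R X) ** R = c *\<^sub>R (Q ** X ** R)" for c X
    by (simp add: matrix_scalar_ac scalar_matrix_assoc)
  show "norm (Q ** X ** R) \<le> norm X * (norm Q * norm R)" for X
    using norm_matrix_mult_le[of "Q ** X" R] norm_matrix_mult_le[of Q X]
    by (smt (verit) mult.commute mult_right_mono norm_ge_zero mult.assoc)
qed

lemma graph_filter_orthogonal_conj:
  assumes "\<forall>x. summable (\<lambda>k. h k * x ^ k)" and "orthogonal_matrix (Q::'n::finite sqmat)"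
  shows "graph_filter h (Q ** A ** transpose Q) = Q ** graph_filter h A ** transpose Q"
proof -
  have "Q ** graph_filter h A ** transpose Q = (\<Sum>k. Q ** (h k *\<^sub>R mat_pow A k) ** transpose Q)"
    unfolding graph_filter_def
    by (rule bounded_linear.suminf[OF bounded_linear_matrix_sandwich summable_graph_filter[OF assms(1)]])
  then show ?thesis
    by (simp add: graph_filter_def mat_pow_orthogonal_conj[OF assms(2)] matrix_scalar_ac scalar_matrix_assoc)
qed

lemma matrix_entry_suminf:
  assumes "summable (X :: nat \<Rightarrow> real^'n^'m)"
  shows "(\<Sum>k. X k) $ i $ j = (\<Sum>k. X k $ i $ j)"
  using bounded_linear.suminf[OF bounded_linear_compose[OF bounded_linear_vec_nth bounded_linear_vec_nth] assms]
  by simp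

lemma graph_filter_diag:
  assumes "\<forall>x. summable (\<lambda>k. h k * x ^ k)" and "diag_matrix (D::'n::finite sqmat)"
  shows "graph_filter h D = (\<chi> i j. if i = j then freq_resp h (D$i$i) else 0)"
proof -
  have "graph_filter h D $ i $ j = (if i = j then freq_resp h (D$i$i) else 0)" for i j
    unfolding graph_filter_def matrix_entry_suminf[OF summable_graph_filter[OF assms(1)]]
    by (simp add: mat_pow_diag[OF assms(2)] freq_resp_def)
  then show ?thesis by (simp add: vec_eq_iff)
qed

lemma spec_norm_graph_filter_symmetric_le:
  assumes "\<forall>x. summable (\<lambda>k. h k * x ^ k)" and "\<forall>x. \<bar>freq_resp h x\<bar> \<le> B"
    and "transpose X = (X::'n::finite sqmat)"
  shows "spec_norm (graph_filter h X) \<le> B"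
proof -
  obtain Q D where QD: "orthogonal_matrix Q" "diag_matrix D" "X = Q ** D ** transpose Q"
    using symmetric_matrix_orthogonally_diagonalizable[OF assms(3)] by blast
  then have "spec_norm (graph_filter h X) = spec_norm (graph_filter h D)"
    by (simp add: graph_filter_orthogonal_conj[OF assms(1)] spec_norm_orthogonal_conj)
  also have "\<dots> \<le> B"
    unfolding graph_filter_diag[OF assms(1) QD(2)]
    by (rule spec_norm_diagonal_le) (simp_all add: assms(2) diag_matrix_def)
  finally show ?thesis .
qed


section \<open>Divided differences of the frequency response\<close>

fun power_divdiff :: "real \<Rightarrow> real \<Rightarrow> nat \<Rightarrow> real" where
  "power_divdiff a b 0 = 0"
| "power_divdiff a b (Suc k) = a * power_divdiff a b k + b ^ k"

lemma power_divdiff_mult_diff: "power_divdiff a b k * (a - b) = a ^ k - b ^ k"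
proof (induction k)
  case (Suc k)
  have "power_divdiff a b (Suc k) * (a - b) = a * (power_divdiff a b k * (a - b)) + b ^ k * (a - b)"
    by (simp add: algebra_simps)
  also have "\<dots> = a * (a ^ k - b ^ k) + b ^ k * (a - b)"
    by (simp only: Suc.IH)
  finally show ?case by (simp add: algebra_simps)
qed simp

lemma power_divdiff_diag: "power_divdiff a a (Suc k) = real (Suc k) * a ^ k"
  by (induction k) (simp_all add: algebra_simps)

lemma abs_power_divdiff_le:
  assumes "\<bar>a\<bar> \<le> m" and "\<bar>b\<bar> \<le> m" and "1 \<le> m"
  shows "\<bar>power_divdiff a b k\<bar> \<le> real k * m ^ k"
proof (induction k)
  case (Suc k)
  have "\<bar>power_divdiff a b (Suc k)\<bar> \<le> \<bar>a\<bar> * \<bar>power_divdiff a b k\<bar> + \<bar>b\<bar> ^ k"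
    by (simp add: abs_mult power_abs[symmetric] abs_triangle_ineq[THEN order_trans])
  also have "\<dots> \<le> m * (real k * m ^ k) + m ^ k"
    using assms Suc by (intro add_mono mult_mono power_mono) auto
  also have "\<dots> \<le> m * (real k * m ^ k) + m ^ Suc k"
    using assms(3) by (simp add: power_increasing)
  finally show ?case by (simp add: algebra_simps)
qed simp

lemma summable_power_divdiff:
  assumes "\<forall>x. summable (\<lambda>k. h k * x ^ k)"
  shows "summable (\<lambda>k. h k * power_divdiff a b k)"
proof (rule summable_comparison_test')
  let ?m = "1 + \<bar>a\<bar> + \<bar>b\<bar>"
  show "summable (\<lambda>k. \<bar>h k\<bar> * real k * ?m ^ k)"
    by (rule summable_abs_powser_mult_nat[OF assms]) simp
  show "norm (h k * power_divdiff a b k) \<le> \<bar>h k\<bar> * real k * ?m ^ k" for k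
    using abs_power_divdiff_le[of a ?m b k] by (simp add: abs_mult mult.assoc mult_left_mono)
qed

definition freq_divdiff :: "(nat \<Rightarrow> real) \<Rightarrow> real \<Rightarrow> real \<Rightarrow> real" where
  "freq_divdiff h a b = (\<Sum>k. h k * power_divdiff a b k)"

lemma freq_divdiff_eq:
  assumes "\<forall>x. summable (\<lambda>k. h k * x ^ k)" and "a \<noteq> b"
  shows "freq_divdiff h a b = (freq_resp h a - freq_resp h b) / (a - b)"
proof -
  have "freq_divdiff h a b * (a - b) = (\<Sum>k. h k * (power_divdiff a b k * (a - b)))"
    unfolding freq_divdiff_def
    using suminf_mult2[OF summable_power_divdiff[OF assms(1)]] by (simp add: mult.assoc)
  also have "\<dots> = (\<Sum>k. h k * a ^ k - h k * b ^ k)"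
    unfolding power_divdiff_mult_diff by (simp add: right_diff_distrib)
  also have "\<dots> = freq_resp h a - freq_resp h b"
    unfolding freq_resp_def using assms(1) by (simp add: suminf_diff)
  finally show ?thesis using assms(2) by (simp add: field_simps)
qed

lemma freq_resp_has_derivative:
  assumes "\<forall>x. summable (\<lambda>k. h k * x ^ k)"
  shows "(freq_resp h has_field_derivative freq_divdiff h a a) (at a)"
proof -
  have "(\<lambda>n. diffs h n * a ^ n) sums (\<Sum>n. diffs h n * a ^ n)"
    using termdiff_converges_all[of h a] assms by (simp add: summable_sums)
  moreover have "(\<lambda>n. diffs h n * a ^ n) = (\<lambda>n. h (Suc n) * power_divdiff a a (Suc n))"
    by (simp add: power_divdiff_diag diffs_def ac_simps del: power_divdiff.simps)
  ultimately have "(\<lambda>n. h (Suc n) * power_divdiff a a (Suc n)) sums (\<Sum>n. diffs h n * a ^ n)"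
    by simp
  then have "(\<lambda>n. h n * power_divdiff a a n) sums (\<Sum>n. diffs h n * a ^ n)"
    using sums_Suc_iff[of "\<lambda>n. h n * power_divdiff a a n"] by simp
  then have "freq_divdiff h a a = (\<Sum>n. diffs h n * a ^ n)"
    unfolding freq_divdiff_def by (rule sums_unique[symmetric])
  moreover have "DERIV (\<lambda>x. \<Sum>n. h n * x ^ n) a :> (\<Sum>n. diffs h n * a ^ n)"
    by (rule termdiffs_strong[of h "\<bar>a\<bar> + 1"]) (use assms in auto)
  ultimately show ?thesis unfolding freq_resp_def[abs_def] by simp
qed

lemma integral_lipschitzD:
  assumes "integral_lipschitz h C" and "l1 + l2 \<noteq> 0"
  shows "\<bar>freq_resp h l2 - freq_resp h l1\<bar> * \<bar>l1 + l2\<bar> \<le> 2 * C * \<bar>l2 - l1\<bar>"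
  using assms unfolding integral_lipschitz_def by (auto simp: field_simps)

lemma integral_lipschitz_deriv_le:
  assumes il: "integral_lipschitz h C" and d: "(freq_resp h has_field_derivative d) (at a)"
    and "a \<noteq> 0"
  shows "\<bar>a * d\<bar> \<le> C"
proof -
  let ?f = "freq_resp h"
  \<comment> \<open>\<open>d\<close> is the limit of difference quotients, each bounded by \<open>2C / \<bar>a + y\<bar>\<close>\<close>
  have "((\<lambda>y. (?f y - ?f a) / (y - a)) \<longlongrightarrow> d) (at a)"
    using d by (simp add: has_field_derivative_iff)
  then have lower: "((\<lambda>y. \<bar>(?f y - ?f a) / (y - a)\<bar>) \<longlongrightarrow> \<bar>d\<bar>) (at a)"
    by (rule tendsto_rabs)
  have upper: "((\<lambda>y. 2 * C / \<bar>a + y\<bar>) \<longlongrightarrow> 2 * C / \<bar>a + a\<bar>) (at a)"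
    using \<open>a \<noteq> 0\<close> by (intro tendsto_intros) auto
  have "\<bar>(?f y - ?f a) / (y - a)\<bar> \<le> 2 * C / \<bar>a + y\<bar>" if "y \<noteq> a" "dist y a < \<bar>a\<bar>" for y
  proof -
    have "y - a \<noteq> 0" "a + y \<noteq> 0" using that by (auto simp: dist_real_def abs_if split: if_splits)
    then show ?thesis using integral_lipschitzD[OF il, of a y] by (simp add: field_simps)
  qed
  then have "\<forall>\<^sub>F y in at a. \<bar>(?f y - ?f a) / (y - a)\<bar> \<le> 2 * C / \<bar>a + y\<bar>"
    unfolding eventually_at using \<open>a \<noteq> 0\<close> by (intro exI[of _ "\<bar>a\<bar>"]) auto
  then have "\<bar>d\<bar> \<le> 2 * C / \<bar>a + a\<bar>"
    by (rule tendsto_le[OF trivial_limit_at upper lower])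
  then show ?thesis using \<open>a \<noteq> 0\<close> by (simp add: abs_mult field_simps)
qed

lemma integral_lipschitz_freq_divdiff_le:
  assumes sm: "\<forall>x. summable (\<lambda>k. h k * x ^ k)" and il: "integral_lipschitz h C"
  shows "\<bar>(a + b) * freq_divdiff h a b\<bar> \<le> 2 * C"
proof -
  have C: "C > 0" using il unfolding integral_lipschitz_def by simp
  consider "a + b = 0" | "a + b \<noteq> 0" "a \<noteq> b" | "a = b" "a \<noteq> 0" by fastforce
  then show ?thesis
  proof cases
    case 1
    then show ?thesis using C by simp
  next
    case 2
    have "\<bar>(a + b) * freq_divdiff h a b\<bar> = \<bar>freq_resp h a - freq_resp h b\<bar> * \<bar>a + b\<bar> / \<bar>a - b\<bar>"
      using 2 by (simp add: freq_divdiff_eq[OF sm] abs_mult)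
    also have "\<dots> \<le> 2 * C * \<bar>a - b\<bar> / \<bar>a - b\<bar>"
      using integral_lipschitzD[OF il, of b a] 2 by (intro divide_right_mono) (simp_all add: add.commute)
    finally show ?thesis using 2 by simp
  next
    case 3
    then show ?thesis
      using integral_lipschitz_deriv_le[OF il freq_resp_has_derivative[OF sm]] by (simp add: abs_mult)
  qed
qed


section \<open>First-order perturbation of graph filters\<close>

text \<open>The first-order term \<open>\<Sum>j<k. S\<^sup>j D S\<^bsup>k-1-j\<^esup>\<close> of \<open>(S + D)\<^sup>k - S\<^sup>k\<close>.\<close>

fun mat_pow_deriv :: "'n::finite sqmat \<Rightarrow> 'n sqmat \<Rightarrow> nat \<Rightarrow> 'n sqmat" where
  "mat_pow_deriv S D 0 = 0"
| "mat_pow_deriv S D (Suc k) = S ** mat_pow_deriv S D k + D ** mat_pow S k"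

lemma norm_matrix_mult_add_le:
  "norm ((A::real^'n^'m) ** (X::real^'k^'n) + B ** Y) \<le> norm A * norm X + norm B * norm Y"
  by (rule order_trans[OF norm_triangle_ineq add_mono[OF norm_matrix_mult_le norm_matrix_mult_le]])

lemma norm_mat_pow_add_diff_le:
  fixes S D :: "'n::finite sqmat"
  assumes R: "norm S + norm D \<le> R" "1 \<le> R"
  shows "norm (mat_pow (S + D) k - mat_pow S k) \<le> norm (mat 1 :: 'n sqmat) * real k * R ^ k * norm D"
proof (induction k)
  case (Suc k)
  let ?c = "norm (mat 1 :: 'n sqmat)"
  have S: "norm S \<le> R" using R norm_ge_zero[of D] by linarith
  have P: "norm (mat_pow (S + D) k) \<le> ?c * R ^ k"
    using R by (intro norm_mat_pow_le) (metis norm_triangle_ineq order_trans)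
  have "mat_pow (S + D) (Suc k) - mat_pow S (Suc k)
      = S ** (mat_pow (S + D) k - mat_pow S k) + D ** mat_pow (S + D) k"
    by (simp add: matrix_add_rdistrib matrix_diff_ldistrib)
  then have "norm (mat_pow (S + D) (Suc k) - mat_pow S (Suc k))
      \<le> norm S * norm (mat_pow (S + D) k - mat_pow S k) + norm D * norm (mat_pow (S + D) k)"
    by (metis norm_matrix_mult_add_le)
  also have "\<dots> \<le> R * (?c * real k * R ^ k * norm D) + norm D * (?c * R ^ Suc k)"
    using R S Suc P power_increasing[of k "Suc k" R]
    by (intro add_mono mult_mono order_trans[OF P]) auto
  also have "\<dots> = ?c * real (Suc k) * R ^ Suc k * norm D"
    by (simp add: algebra_simps)
  finally show ?case .
qed simp

lemma norm_mat_pow_deriv_le: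
  fixes S D :: "'n::finite sqmat"
  assumes R: "norm S + norm D \<le> R" "1 \<le> R"
  shows "norm (mat_pow_deriv S D k) \<le> norm (mat 1 :: 'n sqmat) * real k * R ^ k * norm D"
proof (induction k)
  case (Suc k)
  let ?c = "norm (mat 1 :: 'n sqmat)"
  have S: "norm S \<le> R" using R norm_ge_zero[of D] by linarith
  have "norm (mat_pow_deriv S D (Suc k)) \<le> norm S * norm (mat_pow_deriv S D k) + norm D * norm (mat_pow S k)"
    by (simp add: norm_matrix_mult_add_le)
  also have "\<dots> \<le> R * (?c * real k * R ^ k * norm D) + norm D * (?c * R ^ Suc k)"
    using R S Suc norm_mat_pow_le[OF S, of k] power_increasing[of k "Suc k" R]
    by (intro add_mono mult_mono order_trans[OF norm_mat_pow_le[OF S]]) auto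
  also have "\<dots> = ?c * real (Suc k) * R ^ Suc k * norm D"
    by (simp add: algebra_simps)
  finally show ?case .
qed simp

lemma norm_mat_pow_remainder_le:
  fixes S D :: "'n::finite sqmat"
  assumes R: "norm S + norm D \<le> R" "1 \<le> R"
  shows "norm (mat_pow (S + D) k - mat_pow S k - mat_pow_deriv S D k)
    \<le> norm (mat 1 :: 'n sqmat) * (real k)\<^sup>2 * R ^ k * (norm D)\<^sup>2"
proof (induction k)
  case (Suc k)
  let ?c = "norm (mat 1 :: 'n sqmat)"
  let ?rem = "mat_pow (S + D) k - mat_pow S k - mat_pow_deriv S D k"
  have S: "norm S \<le> R" using R norm_ge_zero[of D] by linarith
  have "mat_pow (S + D) (Suc k) - mat_pow S (Suc k) - mat_pow_deriv S D (Suc k)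
      = S ** ?rem + D ** (mat_pow (S + D) k - mat_pow S k)"
    by (simp add: matrix_add_rdistrib matrix_diff_ldistrib matrix_add_ldistrib algebra_simps)
  then have "norm (mat_pow (S + D) (Suc k) - mat_pow S (Suc k) - mat_pow_deriv S D (Suc k))
      \<le> norm S * norm ?rem + norm D * norm (mat_pow (S + D) k - mat_pow S k)"
    by (metis norm_matrix_mult_add_le)
  also have "\<dots> \<le> R * (?c * (real k)\<^sup>2 * R ^ k * (norm D)\<^sup>2)
      + norm D * (?c * real k * R ^ Suc k * norm D)"
    using R S Suc norm_mat_pow_add_diff_le[OF R, of k] power_increasing[of k "Suc k" R]
    by (intro add_mono mult_mono order_trans[OF norm_mat_pow_add_diff_le[OF R]]) auto
  also have "\<dots> = ?c * ((real k)\<^sup>2 + real k) * R ^ Suc k * (norm D)\<^sup>2"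
    by (simp add: algebra_simps power2_eq_square)
  also have "\<dots> \<le> ?c * (real (Suc k))\<^sup>2 * R ^ Suc k * (norm D)\<^sup>2"
    using R by (intro mult_right_mono mult_left_mono) (auto simp: power2_eq_square algebra_simps)
  finally show ?case .
qed simp

lemma mat_pow_deriv_eigenbasis:
  fixes S D V Lam :: "'n::finite sqmat"
  assumes V: "orthogonal_matrix V" and Lam: "diag_matrix Lam" and S: "S = V ** Lam ** transpose V"
  shows "(transpose V ** mat_pow_deriv S D k ** V) $ a $ b
       = (transpose V ** D ** V) $ a $ b * power_divdiff (Lam$a$a) (Lam$b$b) k"
proof (induction k arbitrary: a b)
  case (Suc k)
  have conj: "transpose V ** mat_pow_deriv S D (Suc k) ** V
      = Lam ** (transpose V ** mat_pow_deriv S D k ** V) + (transpose V ** D ** V) ** mat_pow Lam k"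
    using V unfolding S
    by (simp add: mat_pow_orthogonal_conj matrix_add_ldistrib matrix_add_rdistrib matrix_mul_assoc
        orthogonal_matrix_def orthogonal_matrix_mult_cancel)
  have "(transpose V ** mat_pow_deriv S D (Suc k) ** V) $ a $ b
      = Lam$a$a * (transpose V ** mat_pow_deriv S D k ** V) $ a $ b
        + (transpose V ** D ** V) $ a $ b * (Lam$b$b) ^ k"
    unfolding conj
    by (simp only: vector_add_component diag_matrix_mult_left[OF Lam]
        diag_matrix_mult_right[OF diag_matrix_mat_pow[OF Lam]]) (simp add: mat_pow_diag[OF Lam])
  then show ?case by (simp add: Suc algebra_simps)
qed simp

definition graph_filter_deriv :: "(nat \<Rightarrow> real) \<Rightarrow> 'n::finite sqmat \<Rightarrow> 'n sqmat \<Rightarrow> 'n sqmat" where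
  "graph_filter_deriv h S D = (\<Sum>k. h k *\<^sub>R mat_pow_deriv S D k)"

lemma summable_graph_filter_deriv:
  assumes "\<forall>x. summable (\<lambda>k. h k * x ^ k)"
  shows "summable (\<lambda>k. h k *\<^sub>R mat_pow_deriv (S::'n::finite sqmat) D k)"
proof (rule summable_comparison_test')
  let ?R = "1 + norm S + norm D"
  show "summable (\<lambda>k. (norm (mat 1 :: 'n sqmat) * norm D) * (\<bar>h k\<bar> * real k * ?R ^ k))"
    by (intro summable_mult summable_abs_powser_mult_nat[OF assms]) simp
  show "norm (h k *\<^sub>R mat_pow_deriv S D k)
      \<le> (norm (mat 1 :: 'n sqmat) * norm D) * (\<bar>h k\<bar> * real k * ?R ^ k)" for k
    using mult_left_mono[OF norm_mat_pow_deriv_le[of S D ?R k] abs_ge_zero[of "h k"]]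
    by (simp add: ac_simps)
qed

lemma graph_filter_deriv_eigenbasis:
  fixes S D V Lam :: "'n::finite sqmat"
  assumes sm: "\<forall>x. summable (\<lambda>k. h k * x ^ k)"
    and V: "orthogonal_matrix V" and Lam: "diag_matrix Lam" and S: "S = V ** Lam ** transpose V"
  shows "(transpose V ** graph_filter_deriv h S D ** V) $ a $ b
       = (transpose V ** D ** V) $ a $ b * freq_divdiff h (Lam$a$a) (Lam$b$b)"
proof -
  note sandwich = bounded_linear_matrix_sandwich[of "transpose V" V]
  have "transpose V ** graph_filter_deriv h S D ** V
      = (\<Sum>k. h k *\<^sub>R (transpose V ** mat_pow_deriv S D k ** V))"
    unfolding graph_filter_deriv_def
    using bounded_linear.suminf[OF sandwich summable_graph_filter_deriv[OF sm]]
    by (simp add: matrix_scalar_ac scalar_matrix_assoc)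
  moreover have "summable (\<lambda>k. h k *\<^sub>R (transpose V ** mat_pow_deriv S D k ** V))"
    using bounded_linear.summable[OF sandwich summable_graph_filter_deriv[OF sm]]
    by (simp add: matrix_scalar_ac scalar_matrix_assoc)
  ultimately have "(transpose V ** graph_filter_deriv h S D ** V) $ a $ b
      = (\<Sum>k. (transpose V ** D ** V) $ a $ b * (h k * power_divdiff (Lam$a$a) (Lam$b$b) k))"
    by (simp add: matrix_entry_suminf mat_pow_deriv_eigenbasis[OF V Lam S] ac_simps)
  also have "\<dots> = (transpose V ** D ** V) $ a $ b * freq_divdiff h (Lam$a$a) (Lam$b$b)"
    unfolding freq_divdiff_def by (rule suminf_mult[OF summable_power_divdiff[OF sm]])
  finally show ?thesis .
qed

lemma norm_graph_filter_remainder_le: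
  fixes S D :: "'n::finite sqmat"
  assumes sm: "\<forall>x. summable (\<lambda>k. h k * x ^ k)" and R: "norm S + norm D \<le> R" "1 \<le> R"
  shows "norm (graph_filter h (S + D) - graph_filter h S - graph_filter_deriv h S D)
    \<le> norm (mat 1 :: 'n sqmat) * (\<Sum>k. \<bar>h k\<bar> * (real k)\<^sup>2 * R ^ k) * (norm D)\<^sup>2"
proof -
  let ?c = "norm (mat 1 :: 'n sqmat)"
  let ?rem = "\<lambda>k. mat_pow (S + D) k - mat_pow S k - mat_pow_deriv S D k"
  have H: "summable (\<lambda>k. \<bar>h k\<bar> * (real k)\<^sup>2 * R ^ k)"
    using R by (intro summable_abs_powser_mult_power2[OF sm]) simp
  then have bound: "summable (\<lambda>k. ?c * (norm D)\<^sup>2 * (\<bar>h k\<bar> * (real k)\<^sup>2 * R ^ k))"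
    by (rule summable_mult)
  have rem: "norm (h k *\<^sub>R ?rem k) \<le> ?c * (norm D)\<^sup>2 * (\<bar>h k\<bar> * (real k)\<^sup>2 * R ^ k)" for k
    using mult_left_mono[OF norm_mat_pow_remainder_le[OF R, of k] abs_ge_zero[of "h k"]]
    by (simp add: ac_simps)
  note summable = summable_graph_filter[OF sm] summable_graph_filter_deriv[OF sm]
  have "graph_filter h (S + D) - graph_filter h S - graph_filter_deriv h S D
      = (\<Sum>k. h k *\<^sub>R mat_pow (S + D) k - h k *\<^sub>R mat_pow S k) - (\<Sum>k. h k *\<^sub>R mat_pow_deriv S D k)"
    unfolding graph_filter_def graph_filter_deriv_def
    by (simp add: suminf_diff[OF summable_graph_filter[OF sm] summable_graph_filter[OF sm]])
  also have "\<dots> = (\<Sum>k. h k *\<^sub>R mat_pow (S + D) k - h k *\<^sub>R mat_pow S k - h k *\<^sub>R mat_pow_deriv S D k)"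
    using summable by (intro suminf_diff summable_diff)
  also have "\<dots> = (\<Sum>k. h k *\<^sub>R ?rem k)"
    by (simp add: scaleR_diff_right)
  also have "norm \<dots> \<le> (\<Sum>k. ?c * (norm D)\<^sup>2 * (\<bar>h k\<bar> * (real k)\<^sup>2 * R ^ k))"
    by (rule norm_suminf_le[OF rem bound])
  also have "\<dots> = ?c * (\<Sum>k. \<bar>h k\<bar> * (real k)\<^sup>2 * R ^ k) * (norm D)\<^sup>2"
    by (subst suminf_mult[OF H]) (simp add: ac_simps)
  finally show ?thesis .
qed

definition eigvec_misalignment :: "'n::finite sqmat \<Rightarrow> 'n sqmat \<Rightarrow> real" where
  "eigvec_misalignment U V = (spec_norm (U - V) + 1)\<^sup>2 - 1"

lemma eigvec_misalignment_nonneg: "0 \<le> eigvec_misalignment U V"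
  using one_le_power[of "spec_norm (U - V) + 1" 2] spec_norm_nonneg[of "U - V"]
  by (simp add: eigvec_misalignment_def)

lemma spec_norm_misaligned_conj_diff_le:
  fixes U V M :: "'n::finite sqmat"
  assumes U: "orthogonal_matrix U" and V: "orthogonal_matrix V"
  shows "spec_norm (transpose V ** (U ** M ** transpose U) ** V - M) \<le> eigvec_misalignment U V * spec_norm M"
proof -
  define W where "W = transpose V ** U"
  define \<Delta> where "\<Delta> = W - mat 1"
  define \<delta> where "\<delta> = spec_norm (U - V)"
  have "\<Delta> = transpose V ** (U - V)"
    using V by (simp add: \<Delta>_def W_def matrix_diff_ldistrib orthogonal_matrix_def)
  then have \<Delta>: "spec_norm \<Delta> = \<delta>" "spec_norm (transpose \<Delta>) = \<delta>"
    using V by (simp_all add: \<delta>_def spec_norm_orthogonal_mult_left spec_norm_transpose)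
  have W: "orthogonal_matrix W"
    using U V by (simp add: W_def orthogonal_matrix_mul)
  have "transpose \<Delta> = transpose W - mat 1"
    by (simp add: \<Delta>_def transpose_def mat_def vec_eq_iff)
  then have "transpose V ** (U ** M ** transpose U) ** V - M = W ** M ** transpose \<Delta> + \<Delta> ** M"
    by (simp add: W_def \<Delta>_def matrix_transpose_mul matrix_mul_assoc matrix_diff_ldistrib matrix_diff_rdistrib)
  then have "spec_norm (transpose V ** (U ** M ** transpose U) ** V - M)
      \<le> spec_norm (W ** M ** transpose \<Delta>) + spec_norm (\<Delta> ** M)"
    by (simp add: spec_norm_add_le)
  also have "\<dots> \<le> spec_norm M * \<delta> + \<delta> * spec_norm M"
    using spec_norm_mult_le[of "W ** M" "transpose \<Delta>"] spec_norm_mult_le[of \<Delta> M]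
    by (intro add_mono) (simp_all add: \<Delta> spec_norm_orthogonal_mult_left[OF W])
  also have "\<dots> \<le> eigvec_misalignment U V * spec_norm M"
    using spec_norm_nonneg[of M] spec_norm_nonneg[of "U - V"]
    by (simp add: eigvec_misalignment_def \<delta>_def power2_eq_square algebra_simps)
  finally show ?thesis .
qed

lemma spec_norm_hadamard_le:
  fixes X M :: "'n::finite sqmat"
  assumes G: "\<And>a b. \<bar>G a b\<bar> \<le> g" and M: "diag_matrix M"
  shows "spec_norm (\<chi> a b. G a b * X$a$b) \<le> g * (spec_norm M + sqrt (real CARD('n)) * spec_norm (X - M))"
proof -
  have g: "0 \<le> g" using G abs_ge_zero order_trans by blast
  have split: "(\<chi> a b. G a b * X$a$b) = (\<chi> a b. G a b * M$a$b) + (\<chi> a b. G a b * (X - M)$a$b)"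
    by (simp add: vec_eq_iff algebra_simps)
  have "spec_norm (\<chi> a b. G a b * M$a$b) \<le> g * spec_norm M"
  proof (rule spec_norm_diagonal_le)
    show "diag_matrix (\<chi> a b. G a b * M$a$b)" using M by (simp add: diag_matrix_def)
    show "\<bar>(\<chi> a b. G a b * M$a$b) $ i $ i\<bar> \<le> g * spec_norm M" for i
      using G g abs_entry_le_spec_norm[of M i i] by (simp add: abs_mult mult_mono)
  qed
  moreover have "spec_norm (\<chi> a b. G a b * (X - M)$a$b) \<le> norm (\<chi> a b. G a b * (X - M)$a$b)"
    by (rule spec_norm_le_norm)
  moreover have "\<dots> \<le> g * norm (X - M)"
    by (rule norm_hadamard_le[OF G])
  moreover have "\<dots> \<le> g * (sqrt (real CARD('n)) * spec_norm (X - M))"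
    by (rule mult_left_mono[OF norm_le_sqrt_card_spec_norm g])
  ultimately show ?thesis
    unfolding split by (smt (verit) distrib_left spec_norm_add_le)
qed

lemma spec_norm_graph_filter_deriv_relative_le:
  fixes S V Lam E U M :: "'n::finite sqmat"
  assumes sm: "\<forall>x. summable (\<lambda>k. h k * x ^ k)" and il: "integral_lipschitz h C"
    and V: "orthogonal_matrix V" and Lam: "diag_matrix Lam" and S: "S = V ** Lam ** transpose V"
    and U: "orthogonal_matrix U" and M: "diag_matrix M" and E: "E = U ** M ** transpose U"
  shows "spec_norm (graph_filter_deriv h S (E ** S + S ** E))
    \<le> 2 * C * (1 + eigvec_misalignment U V * sqrt (real CARD('n))) * spec_norm E"
proof -
  define Et where "Et = transpose V ** E ** V"
  define G where "G a b = (Lam$a$a + Lam$b$b) * freq_divdiff h (Lam$a$a) (Lam$b$b)" for a b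
  have "transpose V ** (E ** S + S ** E) ** V = Et ** Lam + Lam ** Et"
    using V by (simp add: Et_def S matrix_add_ldistrib matrix_add_rdistrib matrix_mul_assoc
        orthogonal_matrix_def orthogonal_matrix_mult_cancel)
  then have "(transpose V ** (E ** S + S ** E) ** V) $ a $ b = (Lam$a$a + Lam$b$b) * Et$a$b" for a b
    by (simp add: diag_matrix_mult_left[OF Lam] diag_matrix_mult_right[OF Lam] algebra_simps)
  then have eigenbasis: "transpose V ** graph_filter_deriv h S (E ** S + S ** E) ** V
      = (\<chi> a b. G a b * Et$a$b)"
    by (simp add: vec_eq_iff graph_filter_deriv_eigenbasis[OF sm V Lam S] G_def)
  have "spec_norm (graph_filter_deriv h S (E ** S + S ** E)) = spec_norm (\<chi> a b. G a b * Et$a$b)"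
    using spec_norm_orthogonal_conj[of "transpose V"] V by (simp flip: eigenbasis)
  also have "\<dots> \<le> 2 * C * (spec_norm M + sqrt (real CARD('n)) * spec_norm (Et - M))"
    unfolding G_def by (rule spec_norm_hadamard_le[OF integral_lipschitz_freq_divdiff_le[OF sm il] M])
  also have "\<dots> \<le> 2 * C * (spec_norm M + sqrt (real CARD('n)) * (eigvec_misalignment U V * spec_norm M))"
    using il spec_norm_misaligned_conj_diff_le[OF U V, of M]
    by (intro mult_left_mono add_left_mono) (auto simp: Et_def E integral_lipschitz_def)
  also have "spec_norm M = spec_norm E"
    using U by (simp add: E spec_norm_orthogonal_conj)
  finally show ?thesis by (simp add: algebra_simps)
qed

section \<open>Relative perturbations\<close>

lemma graph_filter_relative_remainder_le:
  fixes S :: "'n::finite sqmat"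
  assumes sm: "\<forall>x. summable (\<lambda>k. h k * x ^ k)"
  shows "\<exists>K\<ge>0. \<forall>E. spec_norm E \<le> 1 \<longrightarrow>
    spec_norm (graph_filter h (S + (E ** S + S ** E)) - graph_filter h S
      - graph_filter_deriv h S (E ** S + S ** E)) \<le> K * (spec_norm E)\<^sup>2"
proof -
  define c where "c = 2 * sqrt (real CARD('n)) * norm S"
  define R where "R = 1 + norm S + c"
  define H where "H = (\<Sum>k. \<bar>h k\<bar> * (real k)\<^sup>2 * R ^ k)"
  have "0 \<le> c" unfolding c_def by simp
  have "0 \<le> H"
    unfolding H_def R_def using \<open>0 \<le> c\<close>
    by (intro suminf_nonneg summable_abs_powser_mult_power2[OF sm]) auto
  show ?thesis
  proof (intro exI[of _ "norm (mat 1 :: 'n sqmat) * H * c\<^sup>2"] conjI allI impI)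
    show "0 \<le> norm (mat 1 :: 'n sqmat) * H * c\<^sup>2" using \<open>0 \<le> H\<close> by simp
    fix E :: "'n sqmat"
    assume E: "spec_norm E \<le> 1"
    define D where "D = E ** S + S ** E"
    have D: "norm D \<le> c * spec_norm E"
      unfolding D_def c_def by (rule order_trans[OF norm_matrix_mult_add_le])
        (use mult_right_mono[OF norm_le_sqrt_card_spec_norm[of E] norm_ge_zero[of S]] in \<open>simp add: ac_simps\<close>)
    then have R: "norm S + norm D \<le> R" "1 \<le> R"
      using mult_left_mono[OF E \<open>0 \<le> c\<close>] \<open>0 \<le> c\<close> norm_ge_zero[of S]
      unfolding R_def by linarith+
    have "spec_norm (graph_filter h (S + D) - graph_filter h S - graph_filter_deriv h S D)
        \<le> norm (graph_filter h (S + D) - graph_filter h S - graph_filter_deriv h S D)"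
      by (rule spec_norm_le_norm)
    also have "\<dots> \<le> norm (mat 1 :: 'n sqmat) * H * (norm D)\<^sup>2"
      unfolding H_def by (rule norm_graph_filter_remainder_le[OF sm R])
    also have "\<dots> \<le> norm (mat 1 :: 'n sqmat) * H * (c * spec_norm E)\<^sup>2"
      using D \<open>0 \<le> H\<close> by (intro mult_left_mono power_mono) auto
    finally show "spec_norm (graph_filter h (S + D) - graph_filter h S - graph_filter_deriv h S D)
        \<le> norm (mat 1 :: 'n sqmat) * H * c\<^sup>2 * (spec_norm E)\<^sup>2"
      by (simp add: power_mult_distrib ac_simps)
  qed
qed

lemma transpose_diag_matrix: "diag_matrix D \<Longrightarrow> transpose D = (D::'n::finite sqmat)"
  unfolding transpose_def diag_matrix_def vec_eq_iff by (metis vec_lambda_beta)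

lemma transpose_diag_conj:
  "diag_matrix D \<Longrightarrow> transpose (Q ** D ** transpose Q) = Q ** D ** (transpose Q :: 'n::finite sqmat)"
  by (simp add: matrix_transpose_mul matrix_mul_assoc transpose_diag_matrix)

lemma transpose_relative_perturbation:
  assumes "transpose S = S" and "transpose E = (E::'n::finite sqmat)"
  shows "transpose (S + (E ** S + S ** E)) = S + (E ** S + S ** E)"
proof -
  have "transpose (X + Y) = transpose X + transpose Y" for X Y :: "'n sqmat"
    by (simp add: transpose_def vec_eq_iff)
  with assms show ?thesis by (simp add: matrix_transpose_mul)
qed

lemma spec_norm_graph_filter_diff_symmetric_le:
  assumes "\<forall>x. summable (\<lambda>k. h k * x ^ k)" and "\<forall>x. \<bar>freq_resp h x\<bar> \<le> B"
    and "transpose X = X" and "transpose Y = (Y::'n::finite sqmat)"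
  shows "spec_norm (graph_filter h X - graph_filter h Y) \<le> 2 * B"
proof -
  have "spec_norm (graph_filter h X - graph_filter h Y) \<le> spec_norm (graph_filter h X) + spec_norm (graph_filter h Y)"
    by (rule spec_norm_diff_le)
  also have "\<dots> \<le> B + B"
    by (intro add_mono spec_norm_graph_filter_symmetric_le[OF assms(1,2)] assms(3,4))
  finally show ?thesis by simp
qed

lemma graph_filter_relative_perturbation_small:
  fixes S V Lam :: "'n::finite sqmat"
  assumes sm: "\<forall>x. summable (\<lambda>k. h k * x ^ k)" and il: "integral_lipschitz h C"
    and V: "orthogonal_matrix V" and Lam: "diag_matrix Lam" and S: "S = V ** Lam ** transpose V"
  shows "\<exists>K\<ge>0. \<forall>E U M. orthogonal_matrix U \<longrightarrow> diag_matrix M \<longrightarrow> E = U ** M ** transpose U \<longrightarrow>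
    spec_norm E \<le> 1 \<longrightarrow>
    spec_norm (graph_filter h (S + (E ** S + S ** E)) - graph_filter h S)
      \<le> 2 * C * (1 + eigvec_misalignment U V * sqrt (real CARD('n))) * spec_norm E + K * (spec_norm E)\<^sup>2"
proof -
  obtain K where "0 \<le> K" and K: "\<And>E. spec_norm E \<le> 1 \<Longrightarrow>
    spec_norm (graph_filter h (S + (E ** S + S ** E)) - graph_filter h S
      - graph_filter_deriv h S (E ** S + S ** E)) \<le> K * (spec_norm E)\<^sup>2"
    using graph_filter_relative_remainder_le[OF sm] by blast
  show ?thesis
  proof (intro exI[of _ K] conjI allI impI)
    fix E U M :: "'n sqmat"
    assume U: "orthogonal_matrix U" "diag_matrix M" "E = U ** M ** transpose U" and E: "spec_norm E \<le> 1"
    let ?X = "graph_filter h (S + (E ** S + S ** E)) - graph_filter h S"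
    let ?F = "graph_filter_deriv h S (E ** S + S ** E)"
    have "spec_norm ?X \<le> spec_norm ?F + spec_norm (?X - ?F)"
      using spec_norm_add_le[of ?F "?X - ?F"] by simp
    also have "\<dots> \<le> 2 * C * (1 + eigvec_misalignment U V * sqrt (real CARD('n))) * spec_norm E
        + K * (spec_norm E)\<^sup>2"
      by (rule add_mono[OF spec_norm_graph_filter_deriv_relative_le[OF sm il V Lam S U] K[OF E]])
    finally show "spec_norm ?X \<le> 2 * C * (1 + eigvec_misalignment U V * sqrt (real CARD('n))) * spec_norm E
        + K * (spec_norm E)\<^sup>2" .
  qed (rule \<open>0 \<le> K\<close>)
qed

lemma spec_norm_graph_filter_relative_perturbation_le_2:
  fixes S V Lam E U M :: "'n::finite sqmat"
  assumes sm: "\<forall>x. summable (\<lambda>k. h k * x ^ k)" and bounded: "\<forall>x. \<bar>freq_resp h x\<bar> \<le> 1"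
    and Lam: "diag_matrix Lam" and S: "S = V ** Lam ** transpose V"
    and M: "diag_matrix M" and E: "E = U ** M ** transpose U"
  shows "spec_norm (graph_filter h (S + (E ** S + S ** E)) - graph_filter h S) \<le> 2"
proof -
  have "transpose S = S" "transpose E = E"
    using Lam M by (simp_all add: S E transpose_diag_conj)
  then show ?thesis
    using spec_norm_graph_filter_diff_symmetric_le[OF sm bounded] transpose_relative_perturbation
    by (metis mult.right_neutral)
qed

lemma graph_filter_relative_perturbation:
  fixes S V Lam :: "'n::finite sqmat"
  assumes sm: "\<forall>x. summable (\<lambda>k. h k * x ^ k)" and bounded: "\<forall>x. \<bar>freq_resp h x\<bar> \<le> 1"
    and il: "integral_lipschitz h C"
    and V: "orthogonal_matrix V" and Lam: "diag_matrix Lam" and S: "S = V ** Lam ** transpose V"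
  shows "\<exists>K. \<forall>E U M \<epsilon>. orthogonal_matrix U \<longrightarrow> diag_matrix M \<longrightarrow> E = U ** M ** transpose U \<longrightarrow>
    spec_norm E \<le> \<epsilon> \<longrightarrow>
    spec_norm (graph_filter h (S + (E ** S + S ** E)) - graph_filter h S)
      \<le> 2 * C * (1 + eigvec_misalignment U V * sqrt (real CARD('n))) * \<epsilon> + K * \<epsilon>\<^sup>2"
proof -
  obtain K where "0 \<le> K" and K: "\<And>E U M. orthogonal_matrix U \<Longrightarrow> diag_matrix M \<Longrightarrow>
    E = U ** M ** transpose U \<Longrightarrow> spec_norm E \<le> 1 \<Longrightarrow>
    spec_norm (graph_filter h (S + (E ** S + S ** E)) - graph_filter h S)
      \<le> 2 * C * (1 + eigvec_misalignment U V * sqrt (real CARD('n))) * spec_norm E + K * (spec_norm E)\<^sup>2"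
    using graph_filter_relative_perturbation_small[OF sm il V Lam S] by blast
  show ?thesis
  proof (intro exI[of _ "max 2 K"] allI impI)
    fix E U M :: "'n sqmat" and \<epsilon> :: real
    assume U: "orthogonal_matrix U" "diag_matrix M" "E = U ** M ** transpose U" and \<epsilon>: "spec_norm E \<le> \<epsilon>"
    let ?coef = "2 * C * (1 + eigvec_misalignment U V * sqrt (real CARD('n)))"
    let ?X = "graph_filter h (S + (E ** S + S ** E)) - graph_filter h S"
    have "0 \<le> ?coef"
      using il eigvec_misalignment_nonneg[of U V] by (simp add: integral_lipschitz_def)
    show "spec_norm ?X \<le> ?coef * \<epsilon> + max 2 K * \<epsilon>\<^sup>2"
    proof (cases "\<epsilon> \<le> 1")
      case True
      have "(spec_norm E)\<^sup>2 \<le> \<epsilon>\<^sup>2" using \<epsilon> spec_norm_nonneg[of E] by (simp add: power_mono)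
      then have "K * (spec_norm E)\<^sup>2 \<le> max 2 K * \<epsilon>\<^sup>2" by (intro mult_mono) auto
      moreover have "?coef * spec_norm E \<le> ?coef * \<epsilon>" using \<epsilon> \<open>0 \<le> ?coef\<close> by (rule mult_left_mono)
      moreover have "spec_norm ?X \<le> ?coef * spec_norm E + K * (spec_norm E)\<^sup>2"
        using \<epsilon> True by (intro K[OF U]) simp
      ultimately show ?thesis by linarith
    next
      case False
      have "spec_norm ?X \<le> 2 * 1"
        using spec_norm_graph_filter_relative_perturbation_le_2[OF sm bounded Lam S U(2,3)] by simp
      also have "\<dots> \<le> max 2 K * \<epsilon>\<^sup>2"
        using False one_le_power[of \<epsilon> 2] by (intro mult_mono) auto
      also have "\<dots> \<le> ?coef * \<epsilon> + max 2 K * \<epsilon>\<^sup>2"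
        using False \<open>0 \<le> ?coef\<close> by simp
      finally show ?thesis .
    qed
  qed
qed


section \<open>Permutation matrices\<close>

lemma transpose_perm_matrix:
  assumes "p permutes (UNIV::'n::finite set)"
  shows "transpose (perm_matrix p :: 'n sqmat) = perm_matrix (inv p)"
proof -
  have "(j = p i) = (i = inv p j)" for i j
    using permutes_inv_eq[OF assms, of j i] by auto
  then show ?thesis by (simp add: transpose_def perm_matrix_def vec_eq_iff)
qed

lemma orthogonal_perm_matrix:
  assumes "p permutes (UNIV::'n::finite set)"
  shows "orthogonal_matrix (perm_matrix p :: 'n sqmat)"
proof -
  have "(transpose (perm_matrix p :: 'n sqmat) ** perm_matrix p) $ i $ j = mat 1 $ i $ j" for i j
  proof -
    have "(transpose (perm_matrix p :: 'n sqmat) ** perm_matrix p) $ i $ j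
        = (\<Sum>k\<in>UNIV. (if k = p i then 1 else 0) * (if k = p j then 1 else 0))"
      by (simp add: matrix_matrix_mult_def transpose_def perm_matrix_def)
    also have "\<dots> = (\<Sum>k\<in>UNIV. if k = p i then (if p i = p j then 1 else 0) else 0)"
      by (rule sum.cong) auto
    also have "\<dots> = mat 1 $ i $ j"
      using permutes_inj[OF assms] by (simp add: mat_def inj_eq)
    finally show ?thesis .
  qed
  then show ?thesis by (simp add: orthogonal_matrix vec_eq_iff)
qed

lemma perm_matrices_orthogonal: "P \<in> perm_matrices \<Longrightarrow> orthogonal_matrix (P::'n::finite sqmat)"
  unfolding perm_matrices_def using orthogonal_perm_matrix by blast

lemma perm_matrices_transpose: "P \<in> perm_matrices \<Longrightarrow> transpose P \<in> (perm_matrices :: 'n::finite sqmat set)"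
  unfolding perm_matrices_def using transpose_perm_matrix permutes_inv by fastforce

lemma perm_op_dist_conj_le:
  assumes "P \<in> perm_matrices"
  shows "perm_op_dist A (P ** B ** transpose P) \<le> spec_norm (A - (B::'n::finite sqmat))"
proof -
  have P: "orthogonal_matrix P" and Pt: "transpose P \<in> perm_matrices"
    using assms by (simp_all add: perm_matrices_orthogonal perm_matrices_transpose)
  have operator: "(\<lambda>x. transpose Q *v (A *v x) - Ah *v (transpose Q *v x))
      = (*v) (transpose Q ** A - Ah ** transpose Q)" for Q Ah :: "'n sqmat"
    by (rule ext) (simp only: matrix_vector_mult_diff_rdistrib matrix_vector_mul_assoc)
  have "perm_op_dist A Ah
      = Inf ((\<lambda>Q. spec_norm (transpose Q ** A - Ah ** transpose Q)) ` perm_matrices)" for Ah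
    unfolding perm_op_dist_def spec_norm_def operator ..
  also have "\<dots> Ah \<le> spec_norm (transpose (transpose P) ** A - Ah ** transpose (transpose P))" for Ah
    by (rule cInf_lower[OF imageI[OF Pt]])
      (auto intro!: bdd_belowI[of _ 0] spec_norm_nonneg)
  finally have "perm_op_dist A (P ** B ** transpose P) \<le> spec_norm (P ** A - P ** B ** transpose P ** P)"
    by simp
  also have "\<dots> = spec_norm (A - B)"
    using P by (simp add: orthogonal_matrix_mult_cancel spec_norm_orthogonal_mult_left
        flip: matrix_diff_ldistrib)
  finally show ?thesis .
qed

lemma perm_op_dist_graph_filter_rel_perts_le:
  assumes sm: "\<forall>x. summable (\<lambda>k. h k * x ^ k)" and E: "E \<in> rel_perts S Sh"
  shows "perm_op_dist (graph_filter h S) (graph_filter h Sh)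
    \<le> spec_norm (graph_filter h (S + (E ** S + S ** E)) - graph_filter h (S::'n::finite sqmat))"
proof -
  obtain P where P: "P \<in> perm_matrices" and PSh: "transpose P ** Sh ** P = S + (E ** S + S ** E)"
    using E unfolding rel_perts_def by blast
  have "Sh = P ** (S + (E ** S + S ** E)) ** transpose P"
    using perm_matrices_orthogonal[OF P] unfolding PSh[symmetric]
    by (simp add: matrix_mul_assoc orthogonal_matrix_def orthogonal_matrix_mult_cancel)
  then have "perm_op_dist (graph_filter h S) (graph_filter h Sh)
      \<le> spec_norm (graph_filter h S - graph_filter h (S + (E ** S + S ** E)))"
    using perm_op_dist_conj_le[OF P]
    by (simp add: graph_filter_orthogonal_conj[OF sm perm_matrices_orthogonal[OF P]])
  then show ?thesis by (simp only: spec_norm_diff_commute)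
qed

theorem theorem2:
  fixes S V Lam :: "real^'n^'n" and h :: "nat \<Rightarrow> real" and C :: real
  assumes "gso S"
    and "orthogonal_matrix V" and "diag_matrix Lam" and "S = V ** Lam ** transpose V"
    and "\<forall>x. summable (\<lambda>k. h k * x ^ k)"
    and "\<forall>x. \<bar>freq_resp h x\<bar> \<le> 1"
    and "integral_lipschitz h C"
  shows "\<exists>K. \<forall>Sh E U M \<epsilon>.
     gso Sh \<longrightarrow> E \<in> rel_perts S Sh \<longrightarrow>
     orthogonal_matrix U \<longrightarrow> diag_matrix M \<longrightarrow> E = U ** M ** transpose U \<longrightarrow>
     rel_dist S Sh \<le> spec_norm E \<longrightarrow> spec_norm E \<le> \<epsilon> \<longrightarrow>
     perm_op_dist (graph_filter h S) (graph_filter h Sh)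
       \<le> 2 * C * (1 + ((spec_norm (U - V) + 1)^2 - 1) * sqrt (real CARD('n))) * \<epsilon>
          + K * \<epsilon>^2"
proof -
  obtain K where K: "\<And>E U M \<epsilon>. orthogonal_matrix U \<Longrightarrow> diag_matrix M \<Longrightarrow> E = U ** M ** transpose U \<Longrightarrow>
    spec_norm E \<le> \<epsilon> \<Longrightarrow> spec_norm (graph_filter h (S + (E ** S + S ** E)) - graph_filter h S)
      \<le> 2 * C * (1 + eigvec_misalignment U V * sqrt (real CARD('n))) * \<epsilon> + K * \<epsilon>\<^sup>2"
    using graph_filter_relative_perturbation[OF assms(5-7,2-4)] by blast
  show ?thesis
  proof (intro exI[of _ K] allI impI)
    fix Sh E U M :: "'n sqmat" and \<epsilon> :: real
    assume "E \<in> rel_perts S Sh" and U: "orthogonal_matrix U" "diag_matrix M" "E = U ** M ** transpose U"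
      and \<epsilon>: "spec_norm E \<le> \<epsilon>"
    then show "perm_op_dist (graph_filter h S) (graph_filter h Sh)
        \<le> 2 * C * (1 + ((spec_norm (U - V) + 1)^2 - 1) * sqrt (real CARD('n))) * \<epsilon> + K * \<epsilon>^2"
      using perm_op_dist_graph_filter_rel_perts_le[OF assms(5)] K[OF U \<epsilon>]
      unfolding eigvec_misalignment_def by (meson order_trans)
  qed
qed

end
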